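(* Let $0<r\le r_1$ and let $\beta=-\frac{\log 3}{\log r}$. Then the $\beta$-dimensional quantization coefficient for $P$ does not exist, i.e. the limit $\lim_{n\to\infty}n^{2/\beta}V_n(P)$ does not exist.
   Context: For $0<r<\frac13$ and $j\in\{1,2,3\}$ let $S_j(x)=rx+\frac{j-1}{2}(1-r)$, $x\in\mathbb R$. Let $P$ be the unique Borel probability measure on $\mathbb R$ with $P=\frac13\sum_{j=1}^3 P\circ S_j^{-1}$. For a finite set $\alpha\subset\mathbb R$ let $V(P;\alpha)=\int\min_{a\in\alpha}(x-a)^2\,dP(x)$, and $V_n(P)=\inf\{V(P;\alpha):\alpha\subset\mathbb R,\ \mathrm{card}(\alpha)\le n\}$. For $s\in(0,\infty)$, the $s$-dimensional quantization coefficient for $P$ is $\lim_{n\to\infty}n^{2/s}V_n(P)$, if it exists. The number $r_1\approx0.2317626315$ is the unique real number $r\in(0,\frac13)$ satisfying $$-\frac{3 r^5+15 r^4+6 r^3-42 r^2+31 r-13}{240 (r+1)}=-\frac{3 r^7+15 r^6+60 r^5+66 r^4+18 r^3-324 r^2+283 r-121}{2184 (r+1)}.$$ The number $\beta$ is the Hausdorff dimension of the support of $P$ (equivalently $3r^\beta=1$). *)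

theory Defs
  imports "HOL-Probability.Probability"
begin

definition S :: "real \<Rightarrow> nat \<Rightarrow> real \<Rightarrow> real" where
  "S r j x = r * x + (real j - 1) / 2 * (1 - r)"

definition self_similar_prob :: "real \<Rightarrow> real measure \<Rightarrow> bool" where
  "self_similar_prob r P \<longleftrightarrow>
     prob_space P \<and> sets P = sets borel \<and>
     (\<forall>A\<in>sets borel. measure P A = 1/3 * (\<Sum>j=1..3. measure P (S r j -` A)))"

definition distortion :: "real measure \<Rightarrow> real set \<Rightarrow> real" where
  "distortion P \<alpha> = (\<integral>x. Min ((\<lambda>a. (x - a)\<^sup>2) ` \<alpha>) \<partial>P)"

text \<open>The minimum over the empty set is meaningless, so \<open>\<alpha>\<close> ranges over nonempty sets.
  The value at \<open>n = 0\<close>, an infimum over the empty set, is irrelevant for the asymptotics.\<close>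

definition quantization_error :: "nat \<Rightarrow> real measure \<Rightarrow> real" where
  "quantization_error n P = Inf {distortion P \<alpha> | \<alpha>. finite \<alpha> \<and> \<alpha> \<noteq> {} \<and> card \<alpha> \<le> n}"

text \<open>The limit is taken in the extended reals: the value \<open>\<infinity>\<close> is a possible
  quantization coefficient, so nonexistence is not mere divergence to \<open>\<infinity>\<close>.\<close>

definition has_quantization_coefficient :: "real \<Rightarrow> real measure \<Rightarrow> ereal \<Rightarrow> bool" where
  "has_quantization_coefficient s P L \<longleftrightarrow>
     (\<lambda>n. ereal (real n powr (2 / s) * quantization_error n P)) \<longlonglongrightarrow> L"

definition r1_equation :: "real \<Rightarrow> bool" where
  "r1_equation r \<longleftrightarrow>
     - ((3*r^5 + 15*r^4 + 6*r^3 - 42*r^2 + 31*r - 13) / (240 * (r + 1))) =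
     - ((3*r^7 + 15*r^6 + 60*r^5 + 66*r^4 + 18*r^3 - 324*r^2 + 283*r - 121) / (2184 * (r + 1)))"

definition r1 :: real where
  "r1 = (THE r. 0 < r \<and> r < 1/3 \<and> r1_equation r)"

lemma r1_ex1: "\<exists>!r. 0 < r \<and> r < 1/3 \<and> r1_equation r"
proof -
  define f where "f r = 30*r^7 + 150*r^6 + 327*r^5 - 705*r^4 - 366*r^3 + 582*r^2 + 9*r - 27"
    for r :: real
  have eq: "r1_equation r \<longleftrightarrow> f r = 0" if "0 < r" for r
  proof -
    have aux: "- (a / (240 * u)) = - (b / (2184 * u)) \<longleftrightarrow> 91 * a = 10 * b" if "u \<noteq> 0" for a b u :: real
      using that by (simp add: frac_eq_eq)
    show ?thesis
      unfolding r1_equation_def f_def using that by (subst aux) (auto simp: algebra_simps)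
  qed
  have mono: "f x < f y" if "0 \<le> x" "x < y" "y \<le> 1/3" for x y
  proof (rule DERIV_pos_imp_increasing_open[OF \<open>x < y\<close>])
    show "\<exists>D. DERIV f t :> D \<and> D > 0" if "x < t" "t < y" for t
    proof -
      have t: "0 < t" "t < 1/3" using that \<open>0 \<le> x\<close> \<open>y \<le> 1/3\<close> by auto
      have d: "DERIV f t :> 210*t^6 + 900*t^5 + 1635*t^4 - 2820*t^3 - 1098*t^2 + 1164*t + 9"
        unfolding f_def by (auto intro!: derivative_eq_intros)
      have a: "t*t \<le> 1/3 * t" using t by (intro mult_right_mono) auto
      have b: "t^3 \<le> 1/9 * t"
      proof -
        have "t^3 = t * (t*t)" by (simp add: power3_eq_cube)
        also have "\<dots> \<le> t * (1/3 * (1/3))" using t by (intro mult_left_mono mult_mono) auto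
        finally show ?thesis by simp
      qed
      have c: "t^6 \<ge> 0" "t^5 \<ge> 0" "t^4 \<ge> 0" using t by auto
      have "0 < 210*t^6 + 900*t^5 + 1635*t^4 - 2820*t^3 - 1098*t^2 + 1164*t + 9"
        using a b c t unfolding power2_eq_square by linarith
      with d show ?thesis by blast
    qed
    show "continuous_on {x..y} f" unfolding f_def by (intro continuous_intros)
  qed
  have "\<exists>r. 0 \<le> r \<and> r \<le> 1/3 \<and> f r = 0"
    by (rule IVT') (auto simp: f_def power_divide intro!: continuous_intros)
  then obtain r where r: "0 \<le> r" "r \<le> 1/3" "f r = 0" by blast
  have "f 0 \<noteq> 0" "f (1/3) \<noteq> 0" by (auto simp: f_def power_divide)
  with r have r': "0 < r" "r < 1/3" by (metis order_le_less)+
  show ?thesis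
  proof (rule ex1I[of _ r])
    show "0 < r \<and> r < 1/3 \<and> r1_equation r" using r r' eq by auto
    show "x = r" if "0 < x \<and> x < 1/3 \<and> r1_equation x" for x
      using that mono[of x r] mono[of r x] eq[of x] r r' by (cases x r rule: linorder_cases) auto
  qed
qed

end

theory Submission
  imports Defs
begin

text \<open>The normalized errors have different limit behaviour along \<open>n = 3 ^ k\<close> and
  \<open>n = 2 * 3 ^ k\<close>. Put \<open>h = (1 - r) / 2\<close>, and note that
  \<open>(3 ^ k) powr (2 / \<beta>) = 1 / r ^ (2 * k)\<close>. Taking the centres of all pieces of level
  \<open>k\<close> as codebook shows that the normalized error at \<open>n = 3 ^ k\<close> is at most the variance
  \<open>2 * h\<^sup>2 / (3 * (1 - r\<^sup>2))\<close>.

  For the lower bound, observe that \<open>n\<close> centres serve \<open>N\<close> points of mutual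
  distance at least \<open>\<delta>\<close> with total squared error at least \<open>(N - n) * \<delta>\<^sup>2 / 2\<close>. Integrating
  with respect to \<open>P\<close> amounts to averaging, over \<open>y\<close> distributed according to \<open>P\<close>, the mean over
  the \<open>N = 3 ^ (k + 1)\<close> images of \<open>y\<close> under the maps of level \<open>k + 1\<close>, and these have
  mutual distance at least \<open>h * r ^ k\<close>. So the error at \<open>n = 2 * 3 ^ k\<close> is at least
  \<open>r ^ (2 * k) * h\<^sup>2 / 6\<close>, and the normalized one at least \<open>2 powr (2 / \<beta>) * h\<^sup>2 / 6\<close>.
  As \<open>2 powr (2 / \<beta>) = 4 powr (1 / \<beta>) > 3 powr (1 / \<beta>) = 1 / r\<close>, this exceeds the upper
  bound along \<open>3 ^ k\<close> as soon as \<open>4 * r \<le> 1 - r\<^sup>2\<close>, which holds for \<open>r \<le> r1\<close>.\<close>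

section \<open>Separated points and few centres\<close>

text \<open>Over all ordered pairs, \<open>(x - y)\<^sup>2\<close> sums to at most
  \<open>2 * m\<close> times the sum of squares about \<open>a\<close>, whatever \<open>a\<close>
  is, while each of the \<open>m * (m - 1)\<close> pairs of distinct points contributes at least
  \<open>\<delta>\<^sup>2\<close>.\<close>

lemma sum_sq_dist_separated:
  fixes X :: "real set"
  assumes "finite X" "0 \<le> \<delta>" and sep: "\<And>x y. x \<in> X \<Longrightarrow> y \<in> X \<Longrightarrow> x \<noteq> y \<Longrightarrow> \<delta> \<le> \<bar>x - y\<bar>"
  shows "(real (card X) - 1) * \<delta>\<^sup>2 / 2 \<le> (\<Sum>x\<in>X. (x - a)\<^sup>2)"
proof (cases "X = {}")
  case False
  define m where "m = real (card X)"
  have m: "m > 0"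
    using False \<open>finite X\<close> by (simp add: m_def card_gt_0_iff)
  have "m * ((m - 1) * \<delta>\<^sup>2) = (\<Sum>x\<in>X. \<Sum>y\<in>X - {x}. \<delta>\<^sup>2)"
    using \<open>finite X\<close> False by (simp add: m_def of_nat_diff Suc_leI card_gt_0_iff)
  also have "\<dots> \<le> (\<Sum>x\<in>X. \<Sum>y\<in>X - {x}. (x - y)\<^sup>2)"
  proof (intro sum_mono)
    fix x y assume "x \<in> X" "y \<in> X - {x}"
    then have "\<delta> \<le> \<bar>x - y\<bar>"
      using sep by auto
    then show "\<delta>\<^sup>2 \<le> (x - y)\<^sup>2"
      using \<open>0 \<le> \<delta>\<close> by (simp flip: abs_le_square_iff)
  qed
  also have "\<dots> \<le> (\<Sum>x\<in>X. \<Sum>y\<in>X. (x - y)\<^sup>2)"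
    using \<open>finite X\<close> by (intro sum_mono sum_mono2) auto
  also have "\<dots> = (\<Sum>x\<in>X. \<Sum>y\<in>X. (x - a)\<^sup>2 + (y - a)\<^sup>2 - 2 * ((x - a) * (y - a)))"
    by (rule sum.cong[OF refl], rule sum.cong[OF refl]) (simp add: power2_eq_square algebra_simps)
  also have "\<dots> = 2 * m * (\<Sum>x\<in>X. (x - a)\<^sup>2) - 2 * (\<Sum>x\<in>X. x - a)\<^sup>2"
    unfolding power2_eq_square[of "\<Sum>x\<in>X. x - a"] sum_product
    by (simp add: sum.distrib sum_subtractf sum_distrib_left m_def mult.assoc)
  also have "\<dots> \<le> m * (2 * (\<Sum>x\<in>X. (x - a)\<^sup>2))"
    by simp
  finally show ?thesis
    using m by (simp add: m_def)
qed (use assms in auto)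

text \<open>Assign each point to a nearest centre. A cell of \<open>m\<close> points costs at least
  \<open>(m - 1) * \<delta>\<^sup>2 / 2\<close>, so each centre saves at most one point; for an
  empty cell this bound is at most zero and still true.\<close>

lemma sum_Min_sq_dist_separated:
  fixes X \<alpha> :: "real set"
  assumes "finite X" "0 \<le> \<delta>" and sep: "\<And>x y. x \<in> X \<Longrightarrow> y \<in> X \<Longrightarrow> x \<noteq> y \<Longrightarrow> \<delta> \<le> \<bar>x - y\<bar>"
    and \<alpha>: "finite \<alpha>" "\<alpha> \<noteq> {}"
  shows "(real (card X) - real (card \<alpha>)) * \<delta>\<^sup>2 / 2 \<le> (\<Sum>x\<in>X. Min ((\<lambda>a. (x - a)\<^sup>2) ` \<alpha>))"
proof -
  have "\<exists>a\<in>\<alpha>. Min ((\<lambda>a. (x - a)\<^sup>2) ` \<alpha>) = (x - a)\<^sup>2" for x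
    using Min_in[of "(\<lambda>a. (x - a)\<^sup>2) ` \<alpha>"] \<alpha> by blast
  then obtain c where c: "\<And>x. c x \<in> \<alpha>" "\<And>x. Min ((\<lambda>a. (x - a)\<^sup>2) ` \<alpha>) = (x - c x)\<^sup>2"
    by metis
  have "real (card X) = (\<Sum>a\<in>\<alpha>. \<Sum>x\<in>{x \<in> X. c x = a}. 1)"
    using sum.group[of X \<alpha> c "\<lambda>_. 1 :: real"] assms c(1) by (simp add: image_subset_iff)
  then have "(real (card X) - real (card \<alpha>)) * \<delta>\<^sup>2 / 2
      = (\<Sum>a\<in>\<alpha>. (real (card {x \<in> X. c x = a}) - 1) * \<delta>\<^sup>2 / 2)"
    by (simp add: sum_subtractf flip: sum_divide_distrib sum_distrib_right)
  also have "\<dots> \<le> (\<Sum>a\<in>\<alpha>. \<Sum>x\<in>{x \<in> X. c x = a}. (x - a)\<^sup>2)"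
    using assms by (intro sum_mono sum_sq_dist_separated) auto
  also have "\<dots> = (\<Sum>a\<in>\<alpha>. \<Sum>x\<in>{x \<in> X. c x = a}. (x - c x)\<^sup>2)"
    by (intro sum.cong) auto
  also have "\<dots> = (\<Sum>x\<in>X. Min ((\<lambda>a. (x - a)\<^sup>2) ` \<alpha>))"
    unfolding c(2) using assms c(1) by (intro sum.group) auto
  finally show ?thesis .
qed

section \<open>Images of a point under the maps of a given level\<close>

text \<open>Points reached from \<open>y\<close> by the \<open>3 ^ k\<close> compositions of
  \<open>k\<close> maps. A set suffices because, for \<open>r < 1/3\<close> and \<open>y\<close> in
  the unit interval, separation of the pieces rules out coincidences.\<close>

fun level_points :: "real \<Rightarrow> nat \<Rightarrow> real \<Rightarrow> real set" where
  "level_points r 0 y = {y}"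
| "level_points r (Suc k) y = (\<Union>j\<in>{1..3}. S r j ` level_points r k y)"

lemma finite_level_points [simp]: "finite (level_points r k y)"
  by (induction k) auto

lemma level_points_nonempty [simp]: "level_points r k y \<noteq> {}"
  by (induction k) auto

lemma S_diff: "S r j x - S r j y = r * (x - y)"
  by (simp add: S_def algebra_simps)

lemma S_center: "S r j x - 1/2 = r * (x - 1/2) + (real j - 2) * ((1 - r) / 2)"
  by (simp add: S_def field_simps)

lemma S_in_unit_interval:
  assumes "0 < r" "r < 1/3" "j \<in> {1..3}" "x \<in> {0..1}"
  shows "S r j x \<in> {0..1}"
proof -
  define p where "p = r * x"
  then have p: "0 \<le> p" "p \<le> r"
    using assms mult_left_le[of x r] by auto
  have "j = 1 \<or> j = 2 \<or> j = 3"
    using assms by auto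
  then show ?thesis
    using assms(1,2) p by (elim disjE) (simp_all add: S_def field_simps flip: p_def)
qed

lemma level_points_in_unit_interval:
  assumes "0 < r" "r < 1/3" "y \<in> {0..1}"
  shows "level_points r k y \<subseteq> {0..1}"
proof (induction k)
  case (Suc k)
  then show ?case
    unfolding level_points.simps
    by (intro UN_least image_subsetI) (rule S_in_unit_interval[OF assms(1,2)], auto)
qed (use assms in auto)

text \<open>The pieces have length \<open>r\<close> and their left endpoints are at least
  \<open>(1 - r) / 2\<close> apart, which leaves a gap of \<open>(1 - r) / 2 - r\<close>.\<close>

lemma S_separated:
  assumes "0 < r" "j \<noteq> i" "x \<in> {0..1}" "y \<in> {0..1}"
  shows "(1 - 3 * r) / 2 \<le> \<bar>S r j x - S r i y\<bar>"
proof -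
  have "\<bar>r * (x - y)\<bar> \<le> r"
    using assms by (auto simp: abs_mult intro!: mult_left_le)
  moreover have "S r j x - S r i y = (real j - real i) * ((1 - r) / 2) + r * (x - y)"
    by (simp add: S_def field_simps)
  moreover have "\<bar>real j - real i\<bar> * \<bar>(1 - r) / 2\<bar> \<ge> 1 * \<bar>(1 - r) / 2\<bar>"
    using assms by (intro mult_right_mono) auto
  then have "\<bar>(real j - real i) * ((1 - r) / 2)\<bar> \<ge> (1 - r) / 2"
    by (simp only: abs_mult)
  ultimately show ?thesis
    by argo
qed

text \<open>Distinct pieces are disjoint, so the union splits. This form trades a level for
  replacing \<open>f\<close> by the sum of its compositions with the three maps.\<close>

lemma sum_level_points_Suc:
  assumes "0 < r" "r < 1/3" "y \<in> {0..1}"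
  shows "(\<Sum>x\<in>level_points r (Suc k) y. f x) = (\<Sum>x\<in>level_points r k y. \<Sum>j=1..3. f (S r j x))"
proof -
  have "S r j x \<noteq> S r i x'" if "j \<noteq> i" "x \<in> level_points r k y" "x' \<in> level_points r k y" for i j x x'
    using S_separated[of r j i x x'] that assms level_points_in_unit_interval[OF assms, of k]
    by (auto simp: subset_iff)
  then have "S r j ` level_points r k y \<inter> S r i ` level_points r k y = {}" if "j \<noteq> i" for i j
    using that by blast
  then have "(\<Sum>x\<in>level_points r (Suc k) y. f x) = (\<Sum>j=1..3. \<Sum>x\<in>S r j ` level_points r k y. f x)"
    unfolding level_points.simps by (intro sum.UNION_disjoint) simp_all
  also have "\<dots> = (\<Sum>j=1..3. \<Sum>x\<in>level_points r k y. f (S r j x))"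
    using assms by (intro sum.cong refl sum.reindex_cong[OF _ refl refl])
      (auto simp: inj_on_def S_def)
  also have "\<dots> = (\<Sum>x\<in>level_points r k y. \<Sum>j=1..3. f (S r j x))"
    by (rule sum.swap)
  finally show ?thesis .
qed

lemma card_level_points:
  assumes "0 < r" "r < 1/3" "y \<in> {0..1}"
  shows "card (level_points r k y) = 3 ^ k"
proof (induction k)
  case (Suc k)
  have "card (level_points r (Suc k) y) = (\<Sum>x\<in>level_points r k y. \<Sum>j::nat=1..3. 1)"
    using sum_level_points_Suc[OF assms, of "\<lambda>_. 1 :: nat" k] by simp
  with Suc show ?case
    by simp
qed simp

text \<open>Through \<open>4 * r \<le> 1 + r\<^sup>2\<close> the hypothesis \<open>4 * r \<le> 1\<close> makes the gap
  \<open>(1 - 3 * r) / 2\<close> between first-level pieces at least \<open>r * (1 - r) / 2\<close>.\<close>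

lemma level_points_separated:
  assumes "0 < r" "4 * r \<le> 1" "y \<in> {0..1}"
    and "u \<in> level_points r (Suc k) y" "v \<in> level_points r (Suc k) y" "u \<noteq> v"
  shows "r ^ k * ((1 - r) / 2) \<le> \<bar>u - v\<bar>"
  using assms(4-6)
proof (induction k arbitrary: u v)
  case 0
  then obtain i j where ij: "u = S r i y" "v = S r j y" "i \<noteq> j"
    by auto
  \<comment> \<open>Both points are images of the same \<open>y\<close>, so \<open>r * y\<close>
    cancels and only the translations differ.\<close>
  have "u - v = (real i - real j) * ((1 - r) / 2)"
    by (simp add: ij S_def field_simps)
  moreover have "\<bar>real i - real j\<bar> * \<bar>(1 - r) / 2\<bar> \<ge> 1 * \<bar>(1 - r) / 2\<bar>"
    using ij by (intro mult_right_mono) auto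
  ultimately have "\<bar>(1 - r) / 2\<bar> \<le> \<bar>u - v\<bar>"
    by (simp only: abs_mult mult_1)
  then show ?case
    by simp
next
  case (Suc k)
  then obtain i j x x' where *: "u = S r i x" "v = S r j x'"
    "x \<in> level_points r (Suc k) y" "x' \<in> level_points r (Suc k) y"
    unfolding level_points.simps(2)[of r "Suc k"] by blast
  show ?case
  \<comment> \<open>Inside one first-level piece, distances shrink by exactly \<open>r\<close> and
    induction applies; across two pieces the gap is already large enough for every level.\<close>
  proof (cases "i = j")
    case True
    then have "\<bar>u - v\<bar> = r * \<bar>x - x'\<bar>" "x \<noteq> x'"
      using * Suc.prems assms by (auto simp: S_diff abs_mult)
    then show ?thesis
      using Suc.IH[of x x'] * assms by (simp add: mult.assoc)
  next
    case False
    have "r ^ Suc k \<le> r"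
      using assms power_decreasing[of 1 "Suc k" r] by simp
    then have "r ^ Suc k * ((1 - r) / 2) \<le> r * ((1 - r) / 2)"
      using assms by (intro mult_right_mono) auto
    also have "\<dots> \<le> (1 - 3 * r) / 2"
    proof -
      have "r * (1 - r) \<le> 1 - 3 * r"
        using assms(2) zero_le_square[of r] unfolding right_diff_distrib by linarith
      then show ?thesis
        by simp
    qed
    also have "\<dots> \<le> \<bar>u - v\<bar>"
      unfolding * using False assms * level_points_in_unit_interval[of r y "Suc k"]
      by (intro S_separated) (auto simp: subset_iff simp del: level_points.simps)
    finally show ?thesis .
  qed
qed

lemma continuous_on_Min_sq_dist:
  fixes \<alpha> :: "real set"
  assumes "finite \<alpha>" "\<alpha> \<noteq> {}"
  shows "continuous_on UNIV (\<lambda>x. Min ((\<lambda>a. (x - a)\<^sup>2) ` \<alpha>))"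
  using assms
proof (induction rule: finite_ne_induct)
  case (insert a \<alpha>)
  then show ?case
    by (simp add: continuous_on_min continuous_intros)
qed (auto intro!: continuous_intros)

section \<open>The self-similar measure\<close>

locale self_similar = prob_space P for P :: "real measure" +
  fixes r :: real
  assumes r_pos: "0 < r" and r_less: "r < 1/3"
    and sets_P [measurable_cong]: "sets P = sets borel"
    and measure_P: "\<And>A. A \<in> sets borel \<Longrightarrow> measure P A = 1/3 * (\<Sum>j=1..3. measure P (S r j -` A))"
begin

lemma space_P [simp]: "space P = UNIV"
  using sets_eq_imp_space_eq[OF sets_P] by simp

lemma prob_UNIV [simp]: "prob UNIV = 1"
  using prob_space by simp

lemma S_measurable [measurable]: "S r j \<in> borel_measurable borel"
  unfolding S_def[abs_def] by measurable

text \<open>Lifts the self-similarity of \<open>P\<close> from sets to functions by the usual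
  induction through simple functions and monotone limits.\<close>

lemma nn_integral_S:
  assumes "f \<in> borel_measurable borel"
  shows "(\<integral>\<^sup>+x. f x \<partial>P) = ennreal (1/3) * (\<Sum>j=1..3. \<integral>\<^sup>+x. f (S r j x) \<partial>P)"
  using assms
proof (induction rule: borel_measurable_induct)
  case (cong f g)
  then show ?case by simp
next
  case (set A)
  have A: "S r j -` A \<in> sets borel" for j
    using measurable_sets[OF S_measurable set] by simp
  have "(\<integral>\<^sup>+x. indicator A (S r j x) \<partial>P) = (\<integral>\<^sup>+x. indicator (S r j -` A) x \<partial>P)" for j
    by (intro nn_integral_cong) (auto simp: indicator_def)
  also have "\<dots> j = ennreal (measure P (S r j -` A))" for j
    using A[of j] by (simp add: sets_P emeasure_eq_measure)
  finally have "(\<Sum>j=1..3. \<integral>\<^sup>+x. indicator A (S r j x) \<partial>P) = ennreal (\<Sum>j=1..3. measure P (S r j -` A))"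
    by (simp add: sum_ennreal)
  then have *: "ennreal (1/3) * (\<Sum>j=1..3. \<integral>\<^sup>+x. indicator A (S r j x) \<partial>P)
      = ennreal (1/3 * (\<Sum>j=1..3. measure P (S r j -` A)))"
    by (simp only: ennreal_mult[symmetric] sum_nonneg measure_nonneg zero_le_divide_1_iff zero_le_numeral)
  have "(\<integral>\<^sup>+x. indicator A x \<partial>P) = ennreal (prob A)"
    using set by (simp add: sets_P emeasure_eq_measure)
  then show ?case
    using measure_P[OF set] * by (simp only:)
next
  case (mult u c)
  then show ?case
    by (simp add: nn_integral_cmult sum_distrib_left mult.left_commute)
next
  case (add u v)
  then show ?case
    by (simp add: nn_integral_add sum.distrib distrib_left)
next
  case (seq U)
  have [measurable]: "U i \<in> borel_measurable borel" for i
    using seq by simp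
  have "incseq (\<lambda>i x. U i (S r j x))" for j
    using \<open>incseq U\<close> by (auto simp: incseq_def le_fun_def)
  then have "ennreal (1/3) * (\<Sum>j=1..3. \<integral>\<^sup>+x. (SUP i. U i (S r j x)) \<partial>P)
      = ennreal (1/3) * (\<Sum>j=1..3. SUP i. \<integral>\<^sup>+x. U i (S r j x) \<partial>P)"
    by (subst nn_integral_monotone_convergence_SUP) auto
  also have "\<dots> = (SUP i. ennreal (1/3) * (\<Sum>j=1..3. \<integral>\<^sup>+x. U i (S r j x) \<partial>P))"
    using \<open>incseq U\<close> by (subst ennreal_SUP_sum[symmetric])
      (auto simp: SUP_mult_left_ennreal incseq_def le_fun_def intro!: nn_integral_mono)
  also have "\<dots> = (\<integral>\<^sup>+x. (SUP i. U i x) \<partial>P)"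
    using seq by (subst nn_integral_monotone_convergence_SUP) auto
  finally show ?case
    by (simp add: image_comp)
qed

text \<open>Since \<open>\<bar>S r j y - 1/2\<bar>\<close> is at most
  \<open>r * \<bar>y - 1/2\<bar> + (1 - r) / 2\<close>, an excess of \<open>s\<close> beyond
  distance \<open>1/2\<close> at the image forces an excess of \<open>s / r\<close> at
  \<open>y\<close>.\<close>

lemma prob_outside_expand:
  assumes "0 \<le> s"
  shows "prob {x. 1/2 + s < \<bar>x - 1/2\<bar>} \<le> prob {x. 1/2 + s / r < \<bar>x - 1/2\<bar>}"
proof -
  have "1/2 + s / r < \<bar>y - 1/2\<bar>" if "j \<in> {1..3}" "1/2 + s < \<bar>S r j y - 1/2\<bar>" for j y
  proof -
    have "\<bar>(real j - 2) * ((1 - r) / 2)\<bar> \<le> (1 - r) / 2"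
      using that r_less by (auto simp: abs_mult intro!: mult_left_le_one_le)
    moreover have "\<bar>r * (y - 1/2)\<bar> = r * \<bar>y - 1/2\<bar>"
      using r_pos by (simp add: abs_mult)
    ultimately have "1/2 + s < r * \<bar>y - 1/2\<bar> + (1 - r) / 2"
      using that(2) abs_triangle_ineq[of "r * (y - 1/2)" "(real j - 2) * ((1 - r) / 2)"]
      unfolding S_center by argo
    then show ?thesis
      using r_pos by (simp add: field_simps)
  qed
  then have "(\<Sum>j=1..3. prob (S r j -` {x. 1/2 + s < \<bar>x - 1/2\<bar>}))
      \<le> (\<Sum>j::nat=1..3. prob {x. 1/2 + s / r < \<bar>x - 1/2\<bar>})"
    by (intro sum_mono finite_measure_mono) (auto simp: sets_P)
  then show ?thesis
    by (subst measure_P) auto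
qed

text \<open>Iterating the expansion pushes the excess to infinity, where the sets shrink to the
  empty set.\<close>

lemma prob_outside:
  assumes "0 < s"
  shows "prob {x. 1/2 + s < \<bar>x - 1/2\<bar>} = 0"
proof -
  have bound: "prob {x. 1/2 + s < \<bar>x - 1/2\<bar>} \<le> prob {x. 1/2 + s / r ^ n < \<bar>x - 1/2\<bar>}" for n
  proof (induction n)
    case (Suc n)
    then show ?case
      using prob_outside_expand[of "s / r ^ n"] assms r_pos by (simp add: mult.commute)
  qed simp
  have "(\<lambda>n. prob {x. 1/2 + s / r ^ n < \<bar>x - 1/2\<bar>}) \<longlonglongrightarrow> prob (\<Inter>n. {x. 1/2 + s / r ^ n < \<bar>x - 1/2\<bar>})"
  proof (rule finite_Lim_measure_decseq)
    show "decseq (\<lambda>n. {x. 1/2 + s / r ^ n < \<bar>x - 1/2\<bar>})"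
    proof (rule decseq_SucI)
      fix n
      have "s / r ^ n \<le> s / r ^ Suc n"
        using assms r_pos r_less by (intro divide_left_mono power_decreasing) auto
      then show "{x. 1/2 + s / r ^ Suc n < \<bar>x - 1/2\<bar>} \<le> {x. 1/2 + s / r ^ n < \<bar>x - 1/2\<bar>}"
        by auto
    qed
  qed (auto simp: sets_P)
  moreover have "(\<Inter>n. {x. 1/2 + s / r ^ n < \<bar>x - 1/2\<bar>}) = {}"
  proof -
    have "\<exists>n. \<bar>x - 1/2\<bar> \<le> 1/2 + s / r ^ n" for x
    proof -
      obtain n where "\<bar>x - 1/2\<bar> / s < (1 / r) ^ n"
        using real_arch_pow[of "1 / r"] r_pos r_less by auto
      then show ?thesis
        using assms by (intro exI[of _ n]) (simp add: field_simps power_divide)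
    qed
    then show ?thesis
      by (auto simp: not_less) (metis not_less)
  qed
  ultimately have "(\<lambda>n. prob {x. 1/2 + s / r ^ n < \<bar>x - 1/2\<bar>}) \<longlonglongrightarrow> 0"
    by simp
  then have "prob {x. 1/2 + s < \<bar>x - 1/2\<bar>} \<le> 0"
    by (rule LIMSEQ_le_const) (use bound in auto)
  then show ?thesis
    using measure_nonneg[of P] by (metis antisym)
qed

text \<open>The complement of the interval is a countable union of null sets. Boundedness of
  continuous functions almost everywhere, hence their integrability, rests on this.\<close>

lemma AE_unit_interval: "AE x in P. x \<in> {0..1}"
proof -
  have "AE x in P. \<forall>n. x \<notin> {x. 1/2 + 1 / real (Suc n) < \<bar>x - 1/2\<bar>}"
    unfolding AE_all_countable
    by (intro allI AE_not_in) (auto simp: null_sets_def sets_P emeasure_eq_measure prob_outside)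
  then show ?thesis
  proof (rule AE_mp, intro AE_I2 impI)
    fix x assume *: "\<forall>n. x \<notin> {x. 1/2 + 1 / real (Suc n) < \<bar>x - 1/2\<bar>}"
    have "\<bar>x - 1/2\<bar> \<le> 1/2"
    proof (rule ccontr)
      assume "\<not> ?thesis"
      then obtain n where "inverse (real (Suc n)) < \<bar>x - 1/2\<bar> - 1/2"
        using reals_Archimedean[of "\<bar>x - 1/2\<bar> - 1/2"] by auto
      moreover have "\<not> 1/2 + 1 / real (Suc n) < \<bar>x - 1/2\<bar>"
        using * by blast
      ultimately show False
        unfolding inverse_eq_divide by argo
    qed
    then show "x \<in> {0..1}"
      unfolding atLeastAtMost_iff by argo
  qed
qed

lemma integrable_continuous:
  fixes f :: "real \<Rightarrow> real"
  assumes "continuous_on UNIV f"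
  shows "integrable P f"
proof -
  have "compact (f ` {0..1})"
    using assms by (intro compact_continuous_image) (auto intro: continuous_on_subset)
  then obtain B where "\<And>x. x \<in> {0..1} \<Longrightarrow> norm (f x) \<le> B"
    using compact_imp_bounded bounded_iff by (metis imageI)
  moreover have [measurable]: "f \<in> borel_measurable borel"
    using assms by (rule borel_measurable_continuous_onI)
  moreover have "random_variable borel f"
    by measurable
  ultimately show ?thesis
    using AE_unit_interval by (intro integrable_const_bound[of _ B]) auto
qed

lemma continuous_on_S: "continuous_on UNIV f \<Longrightarrow> continuous_on UNIV (\<lambda>x. f (S r j x) :: real)"
  unfolding S_def[abs_def] by (rule continuous_on_compose2[of UNIV f]) (auto intro!: continuous_intros)

lemma integral_S:
  fixes f :: "real \<Rightarrow> real"
  assumes f: "continuous_on UNIV f" and nonneg: "\<And>x. 0 \<le> f x"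
  shows "(\<integral>x. f x \<partial>P) = 1/3 * (\<Sum>j=1..3. \<integral>x. f (S r j x) \<partial>P)"
proof -
  have *: "(\<integral>\<^sup>+x. ennreal (g x) \<partial>P) = ennreal (\<integral>x. g x \<partial>P)"
    if "continuous_on UNIV g" "\<And>x. 0 \<le> g x" for g
    using that by (intro nn_integral_eq_integral integrable_continuous) auto
  have [measurable]: "f \<in> borel_measurable borel"
    using f by (rule borel_measurable_continuous_onI)
  have "ennreal (\<integral>x. f x \<partial>P) = ennreal (1/3) * (\<Sum>j=1..3. ennreal (\<integral>x. f (S r j x) \<partial>P))"
    using nn_integral_S[of "\<lambda>x. ennreal (f x)"] *[OF f nonneg] *[OF continuous_on_S[OF f] nonneg]
    by simp
  also have "(\<Sum>j=1..3. ennreal (\<integral>x. f (S r j x) \<partial>P)) = ennreal (\<Sum>j=1..3. \<integral>x. f (S r j x) \<partial>P)"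
    using nonneg by (intro sum_ennreal) simp
  also have "ennreal (1/3) * \<dots> = ennreal (1/3 * (\<Sum>j=1..3. \<integral>x. f (S r j x) \<partial>P))"
    using nonneg by (intro ennreal_mult[symmetric] sum_nonneg) auto
  finally show ?thesis
    using nonneg by (subst (asm) ennreal_inj) (auto intro!: mult_nonneg_nonneg sum_nonneg)
qed

section \<open>Bounds for the distortion\<close>

text \<open>The offsets \<open>(real j - 2) * (1 - r) / 2\<close> sum to zero, so the cross terms
  cancel and self-similarity gives \<open>m = r\<^sup>2 * m + (1 - r)\<^sup>2 / 6\<close>.\<close>

lemma second_moment: "(\<integral>x. (x - 1/2)\<^sup>2 \<partial>P) = (1 - r)\<^sup>2 / (6 * (1 - r\<^sup>2))"
proof -
  define m where "m = (\<integral>x. (x - 1/2)\<^sup>2 \<partial>P)"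
  have "m = 1/3 * (\<Sum>j=1..3. \<integral>x. (S r j x - 1/2)\<^sup>2 \<partial>P)"
    unfolding m_def by (rule integral_S) (auto intro!: continuous_intros)
  also have "(\<Sum>j=1..3. \<integral>x. (S r j x - 1/2)\<^sup>2 \<partial>P) = (\<integral>x. (\<Sum>j=1..3. (S r j x - 1/2)\<^sup>2) \<partial>P)"
    by (rule Bochner_Integration.integral_sum[symmetric])
      (intro integrable_continuous continuous_on_S, auto intro!: continuous_intros)
  also have "\<dots> = (\<integral>x. 3 * r\<^sup>2 * (x - 1/2)\<^sup>2 + (1 - r)\<^sup>2 / 2 \<partial>P)"
    by (intro Bochner_Integration.integral_cong refl)
      (simp add: S_def eval_nat_numeral field_simps)
  also have "\<dots> = 3 * r\<^sup>2 * m + (1 - r)\<^sup>2 / 2"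
    unfolding m_def
    by (subst Bochner_Integration.integral_add)
      (auto intro!: integrable_continuous continuous_intros)
  finally have "m * (6 * (1 - r\<^sup>2)) = (1 - r)\<^sup>2"
    by (simp add: algebra_simps)
  moreover have "r\<^sup>2 < 1"
    using r_pos r_less by (simp add: power_less_one_iff)
  ultimately show ?thesis
    by (simp add: m_def field_simps)
qed

text \<open>If \<open>a\<close> serves \<open>x\<close>, then \<open>S r j a\<close> can serve
  \<open>S r j x\<close> at \<open>r\<^sup>2\<close> times the cost; self-similarity averages this
  over \<open>j\<close>.\<close>

lemma distortion_union_images:
  assumes \<alpha>: "finite \<alpha>" "\<alpha> \<noteq> {}"
  shows "distortion P (\<Union>j\<in>{1..3}. S r j ` \<alpha>) \<le> r\<^sup>2 * distortion P \<alpha>"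
proof -
  let ?d = "\<lambda>\<alpha> x. Min ((\<lambda>a. (x - a)\<^sup>2) ` \<alpha>) :: real"
  let ?B = "\<Union>j\<in>{1..3}. S r j ` \<alpha>"
  have B: "finite ?B" "?B \<noteq> {}"
    using \<alpha> by auto
  have le: "?d ?B (S r j x) \<le> r\<^sup>2 * ?d \<alpha> x" if "j \<in> {1..3}" for j x
  proof -
    obtain a where a: "a \<in> \<alpha>" "?d \<alpha> x = (x - a)\<^sup>2"
      using Min_in[of "(\<lambda>a. (x - a)\<^sup>2) ` \<alpha>"] \<alpha> by blast
    have "?d ?B (S r j x) \<le> (S r j x - S r j a)\<^sup>2"
      using B a that by (intro Min_le finite_imageI imageI) auto
    then show ?thesis
      by (simp add: a S_diff power_mult_distrib)
  qed
  have "distortion P ?B = 1/3 * (\<Sum>j=1..3. \<integral>x. ?d ?B (S r j x) \<partial>P)"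
    unfolding distortion_def using B
    by (intro integral_S continuous_on_Min_sq_dist) (auto simp: Min_ge_iff)
  also have "\<dots> \<le> 1/3 * (\<Sum>j::nat=1..3. \<integral>x. r\<^sup>2 * ?d \<alpha> x \<partial>P)"
    using B \<alpha> le
    by (intro mult_left_mono sum_mono integral_mono integrable_continuous)
      (auto intro!: continuous_on_S continuous_on_Min_sq_dist continuous_intros)
  also have "\<dots> = r\<^sup>2 * distortion P \<alpha>"
    by (simp add: distortion_def)
  finally show ?thesis .
qed

lemma distortion_nonneg: "finite \<alpha> \<Longrightarrow> \<alpha> \<noteq> {} \<Longrightarrow> 0 \<le> distortion P \<alpha>"
  unfolding distortion_def by (intro Bochner_Integration.integral_nonneg) (auto simp: Min_ge_iff)

lemma quantization_error_le:
  assumes "finite \<alpha>" "\<alpha> \<noteq> {}" "card \<alpha> \<le> n"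
  shows "quantization_error n P \<le> distortion P \<alpha>"
  unfolding quantization_error_def using assms distortion_nonneg
  by (intro cInf_lower) (auto intro!: bdd_belowI[of _ 0])

text \<open>Starting from the single centre \<open>1/2\<close>, each refinement triples the codebook
  and gains a factor \<open>r\<^sup>2\<close>.\<close>

lemma quantization_error_power_3:
  "quantization_error (3 ^ k) P \<le> r ^ (2 * k) * ((1 - r)\<^sup>2 / (6 * (1 - r\<^sup>2)))"
proof -
  have "distortion P (level_points r k (1/2)) \<le> r ^ (2 * k) * ((1 - r)\<^sup>2 / (6 * (1 - r\<^sup>2)))"
  proof (induction k)
    case 0
    show ?case
      using second_moment by (simp add: distortion_def)
  next
    case (Suc k)
    have "distortion P (level_points r (Suc k) (1/2)) \<le> r\<^sup>2 * distortion P (level_points r k (1/2))"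
      unfolding level_points.simps by (intro distortion_union_images) auto
    also have "\<dots> \<le> r\<^sup>2 * (r ^ (2 * k) * ((1 - r)\<^sup>2 / (6 * (1 - r\<^sup>2))))"
      using Suc by (intro mult_left_mono) auto
    finally show ?case
      by (simp add: power2_eq_square mult.assoc)
  qed
  moreover have "card (level_points r k (1/2)) = 3 ^ k"
    using r_pos r_less by (intro card_level_points) auto
  ultimately show ?thesis
    using quantization_error_le[of "level_points r k (1/2)" "3 ^ k"] by auto
qed

text \<open>Induction on the level with \<open>f\<close> replaced by the sum of its compositions
  with the three maps, whose integral is three times that of \<open>f\<close>.\<close>

lemma integral_ge_level_points:
  fixes f :: "real \<Rightarrow> real"
  assumes "continuous_on UNIV f" "\<And>x. 0 \<le> f x"
    and "\<And>y. y \<in> {0..1} \<Longrightarrow> c \<le> (\<Sum>x\<in>level_points r k y. f x)"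
  shows "c / 3 ^ k \<le> (\<integral>x. f x \<partial>P)"
  using assms
proof (induction k arbitrary: f)
  case 0
  have "(\<integral>x. c \<partial>P) \<le> (\<integral>x. f x \<partial>P)"
    using 0 AE_unit_interval by (intro integral_mono_AE integrable_continuous) auto
  then show ?case
    by simp
next
  case (Suc k)
  have cont: "continuous_on UNIV (\<lambda>x. \<Sum>j=1..3. f (S r j x))"
    using Suc.prems by (intro continuous_on_sum continuous_on_S)
  have "c / 3 ^ k \<le> (\<integral>x. (\<Sum>j=1..3. f (S r j x)) \<partial>P)"
    using Suc.prems sum_level_points_Suc[OF r_pos r_less, of _ f k]
    by (intro Suc.IH cont sum_nonneg) (auto simp del: level_points.simps)
  also have "\<dots> = (\<Sum>j=1..3. \<integral>x. f (S r j x) \<partial>P)"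
    using Suc.prems
    by (intro Bochner_Integration.integral_sum integrable_continuous continuous_on_S)
  also have "\<dots> = 3 * (\<integral>x. f x \<partial>P)"
    using integral_S[OF Suc.prems(1,2)] by simp
  finally show ?case
    by simp
qed

lemma quantization_error_twice_power_3:
  assumes "4 * r \<le> 1"
  shows "r ^ (2 * k) * ((1 - r)\<^sup>2 / 24) \<le> quantization_error (2 * 3 ^ k) P"
  unfolding quantization_error_def
proof (rule cInf_greatest)
  show "{distortion P \<alpha> |\<alpha>. finite \<alpha> \<and> \<alpha> \<noteq> {} \<and> card \<alpha> \<le> 2 * 3 ^ k} \<noteq> {}"
    by (auto intro!: exI[of _ "{0}"])
next
  fix e assume "e \<in> {distortion P \<alpha> |\<alpha>. finite \<alpha> \<and> \<alpha> \<noteq> {} \<and> card \<alpha> \<le> 2 * 3 ^ k}"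
  then obtain \<alpha> where \<alpha>: "e = distortion P \<alpha>" "finite \<alpha>" "\<alpha> \<noteq> {}" "card \<alpha> \<le> 2 * 3 ^ k"
    by auto
  define \<delta> where "\<delta> = r ^ k * ((1 - r) / 2)"
  have "0 \<le> \<delta>"
    using r_pos r_less by (simp add: \<delta>_def)
  \<comment> \<open>There are \<open>3 ^ Suc k\<close> points and at most \<open>2 * 3 ^ k\<close>
    centres, so at least \<open>3 ^ k\<close> points are in excess.\<close>
  have "3 ^ k * \<delta>\<^sup>2 / 2 \<le> (\<Sum>x\<in>level_points r (Suc k) y. Min ((\<lambda>a. (x - a)\<^sup>2) ` \<alpha>))"
    if y: "y \<in> {0..1}" for y
  proof -
    have "real (card \<alpha>) \<le> 2 * 3 ^ k"
      using \<alpha>(4) by (metis (mono_tags) of_nat_le_iff of_nat_mult of_nat_numeral of_nat_power)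
    moreover have "real (card (level_points r (Suc k) y)) = 3 * 3 ^ k"
      using card_level_points[OF r_pos r_less y, of "Suc k"] by simp
    ultimately have "3 ^ k * \<delta>\<^sup>2 / 2 \<le> (real (card (level_points r (Suc k) y)) - real (card \<alpha>)) * \<delta>\<^sup>2 / 2"
      by (intro divide_right_mono mult_right_mono) auto
    also have "\<dots> \<le> (\<Sum>x\<in>level_points r (Suc k) y. Min ((\<lambda>a. (x - a)\<^sup>2) ` \<alpha>))"
      using level_points_separated[OF r_pos assms y, of _ k] \<alpha> \<open>0 \<le> \<delta>\<close>
      by (intro sum_Min_sq_dist_separated finite_level_points) (auto simp: \<delta>_def simp del: level_points.simps)
    finally show ?thesis .
  qed
  then have "(3 ^ k * \<delta>\<^sup>2 / 2) / 3 ^ Suc k \<le> e"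
    unfolding \<alpha>(1) distortion_def using \<alpha>
    by (intro integral_ge_level_points continuous_on_Min_sq_dist)
      (auto simp: Min_ge_iff simp del: level_points.simps)
  moreover have "(3 ^ k * \<delta>\<^sup>2 / 2) / 3 ^ Suc k = r ^ (2 * k) * ((1 - r)\<^sup>2 / 24)"
    by (simp add: \<delta>_def power_mult_distrib power_divide power_mult power2_eq_square)
  ultimately show "r ^ (2 * k) * ((1 - r)\<^sup>2 / 24) \<le> e"
    by simp
qed

end

text \<open>Any bound up to \<open>sqrt 5 - 2\<close>, the positive root of \<open>4 * r = 1 - r\<^sup>2\<close>, would do.\<close>

lemma r1_less: "r1 < 47/200"
proof -
  \<comment> \<open>Since \<open>240 * 91 = 2184 * 10\<close>, clearing denominators leaves
    \<open>10\<close> times the second numerator minus \<open>91\<close> times the first. A sign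
    change of \<open>f\<close> before \<open>47/200\<close> and uniqueness of the root locate
    \<open>r1\<close>.\<close>
  define f where "f x = 30*x^7 + 150*x^6 + 327*x^5 - 705*x^4 - 366*x^3 + 582*x^2 + 9*x - 27"
    for x :: real
  have eq: "r1_equation x \<longleftrightarrow> f x = 0" if "0 < x" for x
  proof -
    have aux: "- (a / (240 * u)) = - (b / (2184 * u)) \<longleftrightarrow> 91 * a = 10 * b" if "u \<noteq> 0" for a b u :: real
      using that by (simp add: frac_eq_eq)
    show ?thesis
      unfolding r1_equation_def f_def using that by (subst aux) (auto simp: algebra_simps)
  qed
  have f_ends: "f 0 < 0" "0 < f (47/200)"
    by (simp_all add: f_def power_divide)
  have "\<exists>x. 0 \<le> x \<and> x \<le> 47/200 \<and> f x = 0"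
    using f_ends by (intro IVT') (auto simp: f_def intro!: continuous_intros)
  then obtain x where x: "0 \<le> x" "x \<le> 47/200" "f x = 0"
    by blast
  with f_ends have x': "0 < x" "x < 47/200"
    by (metis less_irrefl order_le_less)+
  have "r1 = x"
    unfolding r1_def using x x' eq by (intro the1_equality[OF r1_ex1]) auto
  with x' show ?thesis
    by simp
qed

section \<open>Comparison of the two subsequences\<close>

theorem theorem5p2:
  fixes r \<beta> :: real and P :: "real measure"
  assumes "0 < r" and "r \<le> r1"
    and "\<beta> = - (ln 3 / ln r)"
    and "self_similar_prob r P"
  shows "\<not> (\<exists>L. has_quantization_coefficient \<beta> P L)"
proof
  assume "\<exists>L. has_quantization_coefficient \<beta> P L"
  then obtain L where L: "(\<lambda>n. ereal (real n powr (2 / \<beta>) * quantization_error n P)) \<longlonglongrightarrow> L"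
    by (auto simp: has_quantization_coefficient_def)
  have r: "0 < r" "r < 47/200"
    using assms r1_less by auto
  interpret self_similar P r
    using assms r unfolding self_similar_def self_similar_axioms_def self_similar_prob_def by auto
  \<comment> \<open>The dimension equation \<open>3 * r powr \<beta> = 1\<close>, solved for
    \<open>1 / r\<close>.\<close>
  have powr_3: "3 powr (1 / \<beta>) = 1 / r"
    using r by (simp add: assms(3) powr_def ln_div exp_minus field_simps)
  have \<beta>: "0 < \<beta>"
    using r by (simp add: assms(3) divide_pos_neg)
  \<comment> \<open>The bound \<open>6/100\<close> is chosen to fit
    \<open>4 * 47/200 = 94/100\<close>, whence \<open>4 * r < 1 - r\<^sup>2\<close>.\<close>
  have "r\<^sup>2 < 6/100"
    using power_strict_mono[of r "47/200" 2] r by (simp add: power_divide)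
  then have gap: "4 / (1 - r\<^sup>2) < 1 / r"
    using r by (simp add: field_simps)
  \<comment> \<open>Normalization turns \<open>3 ^ k\<close> into \<open>1 / r ^ (2 * k)\<close>,
    cancelling the decay of the error, so the bounds along both subsequences become independent of
    \<open>k\<close>.\<close>
  have scale: "(real a * 3 ^ k) powr (2 / \<beta>) * r ^ (2 * k) = real a powr (2 / \<beta>)" for a k
  proof -
    have "3 powr (2 / \<beta>) = 3 powr (1 / \<beta>) * 3 powr (1 / \<beta>)"
      by (simp flip: powr_add)
    then have "3 powr (2 / \<beta>) = (1 / r)\<^sup>2"
      by (simp add: powr_3 power2_eq_square)
    moreover have "(3 ^ k) powr (2 / \<beta>) = (3 powr (2 / \<beta>)) ^ k"
      by (simp add: powr_powr mult.commute flip: powr_realpow)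
    ultimately show ?thesis
      using r by (simp add: powr_mult power_divide power_mult)
  qed
  define U where "U = (1 - r)\<^sup>2 / (6 * (1 - r\<^sup>2))"
  define W where "W = 2 powr (2 / \<beta>) * ((1 - r)\<^sup>2 / 24)"
  have "real (3 ^ k) powr (2 / \<beta>) * quantization_error (3 ^ k) P \<le> U" for k
    using mult_left_mono[OF quantization_error_power_3[of k], of "(3 ^ k) powr (2 / \<beta>)"]
      scale[of 1 k] by (simp add: U_def flip: mult.assoc)
  moreover have "(\<lambda>k. ereal (real (3 ^ k) powr (2 / \<beta>) * quantization_error (3 ^ k) P)) \<longlonglongrightarrow> L"
    using LIMSEQ_subseq_LIMSEQ[OF L, of "\<lambda>k. 3 ^ k"] by (simp add: comp_def strict_mono_def)
  ultimately have "L \<le> ereal U"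
    by (intro LIMSEQ_le_const2) auto
  have "W \<le> real (2 * 3 ^ k) powr (2 / \<beta>) * quantization_error (2 * 3 ^ k) P" for k
  proof -
    have "W = (2 * 3 ^ k) powr (2 / \<beta>) * (r ^ (2 * k) * ((1 - r)\<^sup>2 / 24))"
      using scale[of 2 k, symmetric] by (simp add: W_def mult.assoc)
    also have "\<dots> \<le> (2 * 3 ^ k) powr (2 / \<beta>) * quantization_error (2 * 3 ^ k) P"
      using r by (intro mult_left_mono quantization_error_twice_power_3) auto
    finally show ?thesis
      by simp
  qed
  moreover have "(\<lambda>k. ereal (real (2 * 3 ^ k) powr (2 / \<beta>) * quantization_error (2 * 3 ^ k) P)) \<longlonglongrightarrow> L"
    using LIMSEQ_subseq_LIMSEQ[OF L, of "\<lambda>k. 2 * 3 ^ k"] by (simp add: comp_def strict_mono_def)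
  ultimately have "ereal W \<le> L"
    by (intro LIMSEQ_le_const) auto
  \<comment> \<open>With the common factor \<open>(1 - r)\<^sup>2 / 24\<close> removed, the chain is
    \<open>4 / (1 - r\<^sup>2) < 1 / r = 3 powr (1 / \<beta>) < 4 powr (1 / \<beta>) = 2 powr (2 /
    \<beta>)\<close>.\<close>
  have "U = 4 / (1 - r\<^sup>2) * ((1 - r)\<^sup>2 / 24)"
    using \<open>r\<^sup>2 < 6/100\<close> by (simp add: U_def field_simps)
  also have "\<dots> < 1 / r * ((1 - r)\<^sup>2 / 24)"
    using gap r by (intro mult_strict_right_mono) auto
  also have "1 / r < 4 powr (1 / \<beta>)"
    unfolding powr_3[symmetric] using \<beta> by (intro powr_less_mono2) auto
  then have "1 / r * ((1 - r)\<^sup>2 / 24) < 4 powr (1 / \<beta>) * ((1 - r)\<^sup>2 / 24)"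
    using r by (intro mult_strict_right_mono) auto
  also have "4 powr (1 / \<beta>) = (2 powr 2) powr (1 / \<beta>)"
    by simp
  also have "\<dots> = 2 powr (2 / \<beta>)"
    by (subst powr_powr) simp
  finally have "U < W"
    by (simp add: W_def)
  with \<open>L \<le> ereal U\<close> \<open>ereal W \<le> L\<close> show False
    by (metis ereal_less_eq(3) leD order_trans)
qed

end
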